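(* For any $\epsilon\in(0,0.9)$, any $O(1)$-pass $(1+\epsilon,0.49)$-approximation streaming algorithm (in the node-arrival model) for computing the diversity index $\mathrm{DI}(\sigma)=\sum_{i\in[n]} d_i^{-1}$ on a data stream $\sigma$ of length $n$ needs $\Omega\left(\min\left(\sqrt{\frac{n}{\epsilon}},\,n\right)\right)$ bits of space.
   Context: Similarity graph. $U$ is a universe of items and $f:U\times U\to[0,1]$ is a symmetric similarity function with $f(x,x)=1$ for all $x\in U$. For a stream $\sigma=(\sigma_1,\dots,\sigma_n)\in U^n$, the degree of node $i\in[n]$ in the similarity graph $G^\sigma$ (complete graph on $[n]$ with self-loops, weights $w(i,j)=f(\sigma_i,\sigma_j)$) is $d_i=\sum_{j\in[n]} f(\sigma_i,\sigma_j)$. Node-arrival streaming model. The items $\sigma_1,\dots,\sigma_n$ arrive sequentially and the algorithm, which has access to $f$, makes one or more linear scans (passes) over them while maintaining a bounded memory state. Algorithms are randomized; the algorithm's guarantee is required for every universe $U$, every similarity function $f$ and every stream $\sigma$ of length $n$, and its space is the worst-case number of bits of memory. Approximation. For $\epsilon\in(0,1)$, $\tilde X$ is a $(1+\epsilon,\delta)$-approximation of $X$ if $(1-\epsilon)X\le\tilde X\le(1+\epsilon)X$ with probability at least $1-\delta$. The constant hidden in $\Omega(\cdot)$ is independent of $n$ and $\epsilon$ (it may depend on the constant number of passes). *)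

theory Defs
  imports "HOL-Probability.Probability"
begin

definition similarity :: "'a set \<Rightarrow> ('a \<Rightarrow> 'a \<Rightarrow> real) \<Rightarrow> bool" where
  "similarity U f \<longleftrightarrow>
     (\<forall>x\<in>U. \<forall>y\<in>U. f x y \<in> {0..1} \<and> f x y = f y x) \<and> (\<forall>x\<in>U. f x x = 1)"

text \<open>Nodes of the similarity graph are the stream positions, numbered from 0; the
  sum includes the self-loop.\<close>

definition node_degree :: "('a \<Rightarrow> 'a \<Rightarrow> real) \<Rightarrow> 'a list \<Rightarrow> nat \<Rightarrow> real" where
  "node_degree f xs i = (\<Sum>j<length xs. f (xs ! i) (xs ! j))"

definition DI :: "('a \<Rightarrow> 'a \<Rightarrow> real) \<Rightarrow> 'a list \<Rightarrow> real" where
  "DI f xs = (\<Sum>i<length xs. inverse (node_degree f xs i))"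

text \<open>Randomness is an infinite read-only tape of independent fair coin tosses. Neither the
  tape nor the clock (the number of items read so far, over all passes) is charged as memory.
  Since disjoint parts of the tape can be reserved for different times, this covers
  algorithms that toss fresh coins at every step, as well as those with shared randomness.\<close>

type_synonym tape = "nat \<Rightarrow> bool"

definition coins :: "tape measure" where
  "coins = (\<Pi>\<^sub>M i\<in>UNIV. measure_pmf (bernoulli_pmf (1/2)))"

record 'a machine =
  start :: "tape \<Rightarrow> bool list"
  step :: "tape \<Rightarrow> nat \<Rightarrow> 'a \<Rightarrow> bool list \<Rightarrow> bool list"
  result :: "tape \<Rightarrow> bool list \<Rightarrow> real"

text \<open>Access to the similarity function: the machine that is run may depend arbitrarily on the
  universe and on the similarity function, but on the stream only through the items as they
  are read.\<close>

type_synonym 'a algorithm = "'a set \<Rightarrow> ('a \<Rightarrow> 'a \<Rightarrow> real) \<Rightarrow> 'a machine"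

text \<open>Memory content after \<open>t\<close> steps of repeated left-to-right scans of \<open>xs\<close>; step \<open>t\<close>
  belongs to pass \<open>t div length xs\<close> (counted from 0).\<close>

primrec memory :: "'a machine \<Rightarrow> tape \<Rightarrow> 'a list \<Rightarrow> nat \<Rightarrow> bool list" where
  "memory M r xs 0 = start M r"
| "memory M r xs (Suc t) = step M r t (xs ! (t mod length xs)) (memory M r xs t)"

definition final_output :: "nat \<Rightarrow> 'a machine \<Rightarrow> 'a list \<Rightarrow> tape \<Rightarrow> real" where
  "final_output p M xs r = result M r (memory M r xs (p * length xs))"

definition instances :: "nat \<Rightarrow> ('a set \<times> ('a \<Rightarrow> 'a \<Rightarrow> real) \<times> 'a list) set" where
  "instances n = {(U, f, xs). similarity U f \<and> set xs \<subseteq> U \<and> length xs = n}"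

text \<open>As \<open>measure\<close> is 0 on non-measurable sets, for \<open>\<delta> < 1\<close> this entails that the
  success event is measurable.\<close>

definition approximation :: "'b measure \<Rightarrow> real \<Rightarrow> real \<Rightarrow> ('b \<Rightarrow> real) \<Rightarrow> real \<Rightarrow> bool" where
  "approximation P \<epsilon> \<delta> Y x \<longleftrightarrow>
     measure P {r \<in> space P. (1 - \<epsilon>) * x \<le> Y r \<and> Y r \<le> (1 + \<epsilon>) * x} \<ge> 1 - \<delta>"

definition approximates_DI :: "nat \<Rightarrow> nat \<Rightarrow> real \<Rightarrow> real \<Rightarrow> 'a algorithm \<Rightarrow> bool" where
  "approximates_DI p n \<epsilon> \<delta> A \<longleftrightarrow>
     (\<forall>(U, f, xs) \<in> instances n. approximation coins \<epsilon> \<delta> (final_output p (A U f) xs) (DI f xs))"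

text \<open>Worst-case number of memory bits over all inputs of length \<open>n\<close>, all coin tosses and
  all times during \<open>p\<close> passes.\<close>

definition space_bits :: "nat \<Rightarrow> nat \<Rightarrow> 'a algorithm \<Rightarrow> enat" where
  "space_bits p n A =
     (SUP (U, f, xs) \<in> instances n. SUP r \<in> space coins. SUP t \<in> {..p * n}.
        enat (length (memory (A U f) r xs t)))"

end

theory Submission
  imports Defs
begin

text \<open>The theorem reduces to unique set disjointness. For every \<open>i < m\<close> one player streams
  \<open>k\<close> distinct leaves and the other \<open>k\<close> copies of a hub, arranged so that only an index held by both
  players isolates the leaves. This raises the index, otherwise a known number of order \<open>m\<close>, by
  about \<open>k\<close>, which is more than the error once \<open>k \<gg> \<epsilon> m\<close>; with \<open>m k \<approx> n\<close> this allows
  \<open>m \<approx> min (sqrt (n / \<epsilon>)) n\<close>.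

  The memory states at the boundary between the two parts cut the pairs of inputs into combinatorial
  rectangles. Split a random set \<open>Z\<close> along a random \<open>D\<close> into disjoint inputs. If there are few
  rectangles, then by the level-1 inequality toggling a typical coordinate of \<open>Z\<close>
  hardly changes the distribution of the transcript in Hellinger distance. As the transcript
  probabilities are of product form, putting \<open>i\<close> into both inputs then hardly changes
  it either.\<close>

section \<open>The level-1 inequality on the cube\<close>

lemma cosh_real_le_exp_half_square: "cosh x \<le> exp (x\<^sup>2 / 2)" for x :: real
proof -
  define y where "y = \<bar>x\<bar>"
  \<comment> \<open>With step \<open>2 * y\<close> and probability \<open>1/2\<close>, the logarithm
    in the inequality behind Hoeffding's lemma is that of \<open>exp y * cosh y\<close>. That
    inequality wants a nonnegative step, hence the absolute value.\<close>
  have *: "1 + 1/2 * (exp (2 * y) - 1) = exp y * cosh y"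
    by (simp add: cosh_field_def algebra_simps flip: exp_add)
  have "ln (exp y * cosh y) = y + ln (cosh y)"
    by (subst ln_mult_pos) (auto simp: cosh_real_pos)
  then have "ln (cosh y) \<le> y\<^sup>2 / 2"
    using Hoeffdings_lemma_aux[of "2 * y" "1/2"] unfolding * by (simp add: y_def)
  then have "cosh y \<le> exp (y\<^sup>2 / 2)"
    by (metis cosh_real_pos exp_le_cancel_iff exp_ln)
  then show ?thesis
    by (simp add: y_def abs_if split: if_splits)
qed

text \<open>Of the two arguments one is \<open>D\<close> itself and the other is \<open>D\<close>
  with \<open>i\<close> toggled, and toggling permutes \<open>Pow I\<close>.\<close>

lemma sum_Pow_remove_insert:
  fixes g :: "'i set \<Rightarrow> real"
  assumes "finite I" "i \<in> I"
  shows "(\<Sum>D\<in>Pow I. g (D - {i}) + g (insert i D)) = 2 * (\<Sum>D\<in>Pow I. g D)"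
proof -
  define flip where "flip D = (if i \<in> D then D - {i} else insert i D)" for D
  have "(\<Sum>D\<in>Pow I. g (D - {i}) + g (insert i D)) = (\<Sum>D\<in>Pow I. g D + g (flip D))"
    by (intro sum.cong refl) (auto simp: flip_def insert_absorb)
  moreover have "(\<Sum>D\<in>Pow I. g (flip D)) = (\<Sum>D\<in>Pow I. g D)"
    by (rule sum.reindex_bij_witness[of _ flip flip]) (use assms in \<open>auto simp: flip_def insert_absorb\<close>)
  ultimately show ?thesis
    by (simp add: sum.distrib)
qed

definition walsh :: "'i \<Rightarrow> 'i set \<Rightarrow> real" where
  "walsh i Z = (if i \<in> Z then -1 else 1)"

text \<open>The signs of a uniformly random subset are independent, so the exponential moment
  factorises. Formally, a product of binary sums is expanded over the subsets
  \<open>Z\<close>.\<close>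

lemma sum_Pow_exp_walsh:
  assumes "finite I"
  shows "(\<Sum>Z\<in>Pow I. exp (\<Sum>i\<in>I. b i * walsh i Z)) = 2 ^ card I * (\<Prod>i\<in>I. cosh (b i))"
proof -
  have "(\<Sum>Z\<in>Pow I. exp (\<Sum>i\<in>I. b i * walsh i Z))
      = (\<Sum>Z\<in>Pow I. (\<Prod>i\<in>Z. exp (- b i)) * (\<Prod>i\<in>I - Z. exp (b i)))"
  proof (intro sum.cong refl)
    fix Z assume Z: "Z \<in> Pow I"
    then have "(\<Sum>i\<in>I. b i * walsh i Z) = (\<Sum>i\<in>I - Z. b i * walsh i Z) + (\<Sum>i\<in>Z. b i * walsh i Z)"
      using assms by (intro sum.subset_diff) auto
    also have "\<dots> = (\<Sum>i\<in>I - Z. b i) + (\<Sum>i\<in>Z. - b i)"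
      by (intro arg_cong2[of _ _ _ _ "(+)"] sum.cong) (auto simp: walsh_def)
    finally show "exp (\<Sum>i\<in>I. b i * walsh i Z) = (\<Prod>i\<in>Z. exp (- b i)) * (\<Prod>i\<in>I - Z. exp (b i))"
      using Z assms finite_subset[of Z I] by (simp only: exp_add exp_sum Pow_iff finite_Diff) simp
  qed
  also have "\<dots> = (\<Prod>i\<in>I. exp (- b i) + exp (b i))"
    by (rule prod_add[symmetric]) fact
  also have "\<dots> = (\<Prod>i\<in>I. 2 * cosh (b i))"
    by (intro prod.cong refl) (simp add: cosh_field_def)
  also have "\<dots> = 2 ^ card I * (\<Prod>i\<in>I. cosh (b i))"
    by (simp add: prod.distrib)
  finally show ?thesis .
qed

text \<open>The level-1 inequality for Fourier coefficients on the cube. With \<open>b\<close> the vector of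
  biases, compare the average of \<open>exp (b \<bullet> walsh Z)\<close> over \<open>A\<close> (bounded below by convexity) with
  its average over the cube.\<close>

lemma level_one_inequality:
  fixes I :: "'i set" and A :: "'i set set"
  assumes "finite I" "A \<subseteq> Pow I" "A \<noteq> {}"
  shows "(\<Sum>i\<in>I. ((\<Sum>Z\<in>A. walsh i Z) / card A)\<^sup>2) \<le> 2 * ln (2 ^ card I / card A)"
proof -
  define b where "b i = (\<Sum>Z\<in>A. walsh i Z) / card A" for i
  define L where "L Z = (\<Sum>i\<in>I. b i * walsh i Z)" for Z
  define q where "q = (\<Sum>i\<in>I. (b i)\<^sup>2)"
  have A: "finite A" "card A > 0"
    using assms by (auto intro: finite_subset simp: card_gt_0_iff)
  have "(\<Sum>Z\<in>A. L Z) = (\<Sum>i\<in>I. \<Sum>Z\<in>A. b i * walsh i Z)"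
    unfolding L_def by (rule sum.swap)
  also have "\<dots> = (\<Sum>i\<in>I. b i * (card A * b i))"
    using A by (intro sum.cong refl) (subst sum_distrib_left[symmetric], simp add: b_def)
  also have "\<dots> = card A * q"
    by (simp add: q_def sum_distrib_left power2_eq_square mult_ac)
  finally have mean: "(\<Sum>Z\<in>A. L Z) = card A * q" .
  \<comment> \<open>The tangent to \<open>exp\<close> at \<open>q\<close> is used because
    \<open>q\<close> is the mean of \<open>L\<close> over \<open>A\<close>, so that the linear term
    sums to zero.\<close>
  have "card A * exp q = (\<Sum>Z\<in>A. exp q * (1 + (L Z - q)))"
    by (simp add: sum.distrib sum_subtractf mean flip: sum_distrib_left)
  also have "\<dots> \<le> (\<Sum>Z\<in>A. exp q * exp (L Z - q))"
    by (intro sum_mono mult_left_mono) auto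
  also have "\<dots> = (\<Sum>Z\<in>A. exp (L Z))"
    by (simp flip: exp_add)
  also have "\<dots> \<le> (\<Sum>Z\<in>Pow I. exp (L Z))"
    using assms by (intro sum_mono2) auto
  also have "\<dots> = 2 ^ card I * (\<Prod>i\<in>I. cosh (b i))"
    unfolding L_def using assms(1) by (rule sum_Pow_exp_walsh)
  also have "\<dots> \<le> 2 ^ card I * (\<Prod>i\<in>I. exp ((b i)\<^sup>2 / 2))"
    by (intro mult_left_mono prod_mono) (auto simp: cosh_real_le_exp_half_square cosh_real_nonneg)
  also have "(\<Prod>i\<in>I. exp ((b i)\<^sup>2 / 2)) = exp (q / 2)"
    using assms(1) by (simp add: q_def exp_sum sum_divide_distrib)
  finally have "card A * (exp (q / 2) * exp (q / 2)) \<le> 2 ^ card I * exp (q / 2)"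
    by (simp flip: exp_add)
  then have "exp (q / 2) \<le> 2 ^ card I / card A"
    using A by (simp add: field_simps)
  then have "q / 2 \<le> ln (2 ^ card I / card A)"
    using A by (subst ln_ge_iff) auto
  then show ?thesis
    by (simp add: q_def b_def)
qed

section \<open>Hellinger distance under toggling a coordinate\<close>

text \<open>The factor \<open>(sqrt p + sqrt q)^2\<close> of \<open>(p - q)^2\<close> is at least
  \<open>p + q\<close>. This passes from differences of counts, which Fourier coefficients measure,
  to squared Hellinger distance.\<close>

lemma sqrt_diff_square_le:
  assumes "0 \<le> p" "0 \<le> q" "0 < p + q"
  shows "(sqrt p - sqrt q)\<^sup>2 \<le> (p - q)\<^sup>2 / (p + q)"
proof -
  have "(p - q)\<^sup>2 = (sqrt p - sqrt q)\<^sup>2 * (sqrt p + sqrt q)\<^sup>2"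
    using assms by (simp flip: power_mult_distrib add: algebra_simps)
  moreover have "p + q \<le> (sqrt p + sqrt q)\<^sup>2"
    using assms by (simp add: power2_sum)
  ultimately show ?thesis
    using assms by (simp add: pos_le_divide_eq mult_left_mono)
qed

text \<open>The two counts are twice the number of members of \<open>A\<close> in
  \<open>Pow I\<close> without \<open>i\<close> and with \<open>i\<close>. Their sum is twice the
  size of the family and their difference twice its sum of signs at \<open>i\<close>, so each
  summand is governed by a squared bias and the level-1 inequality applies.\<close>

lemma hellinger_flip_sum_le:
  fixes I :: "'i set" and A :: "'i set set"
  defines "N P \<equiv> real (card {Z \<in> Pow I. P Z})"
  assumes "finite I"
  shows "(\<Sum>i\<in>I. (sqrt (N (\<lambda>Z. Z - {i} \<in> A)) - sqrt (N (\<lambda>Z. insert i Z \<in> A)))\<^sup>2)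
      \<le> 4 * N (\<lambda>Z. Z \<in> A) * ln (2 ^ card I / N (\<lambda>Z. Z \<in> A))"
    (is "?lhs \<le> _")
proof -
  define B where "B = {Z \<in> Pow I. Z \<in> A}"
  define b where "b i = (\<Sum>Z\<in>B. walsh i Z) / card B" for i
  have NB: "N (\<lambda>Z. Z \<in> A) = card B"
    by (simp add: N_def B_def)
  have N: "N P = (\<Sum>Z\<in>Pow I. of_bool (P Z))" for P
    using assms by (simp add: N_def Int_def)
  have plus: "N (\<lambda>Z. Z - {i} \<in> A) + N (\<lambda>Z. insert i Z \<in> A) = 2 * card B" if "i \<in> I" for i
    using sum_Pow_remove_insert[OF \<open>finite I\<close> that, of "\<lambda>Z. of_bool (Z \<in> A)"]
    by (simp add: sum.distrib flip: N NB)
  have minus: "N (\<lambda>Z. Z - {i} \<in> A) - N (\<lambda>Z. insert i Z \<in> A) = 2 * (\<Sum>Z\<in>B. walsh i Z)"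
    if "i \<in> I" for i
  proof -
    have "(\<Sum>Z\<in>Pow I. of_bool (Z - {i} \<in> A) - of_bool (insert i Z \<in> A))
        = 2 * (\<Sum>Z\<in>Pow I. of_bool (Z \<in> A) * walsh i Z)"
      using sum_Pow_remove_insert[OF \<open>finite I\<close> that, of "\<lambda>Z. of_bool (Z \<in> A) * walsh i Z"]
      by (simp add: walsh_def)
    also have "(\<Sum>Z\<in>Pow I. of_bool (Z \<in> A) * walsh i Z) = (\<Sum>Z\<in>B. walsh i Z)"
      using \<open>finite I\<close> unfolding B_def by (intro sum.mono_neutral_cong_right) auto
    finally show ?thesis
      by (simp add: N sum_subtractf)
  qed
  show ?thesis
  proof (cases "B = {}")
    case True
    then have "N (\<lambda>Z. Z - {i} \<in> A) = 0 \<and> N (\<lambda>Z. insert i Z \<in> A) = 0" if "i \<in> I" for i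
      using plus[OF that] by (simp add: N_def)
    then show ?thesis
      by (simp add: NB True)
  next
    case False
    have B: "B \<subseteq> Pow I" "card B > 0"
      using False assms by (auto simp: B_def card_gt_0_iff)
    have "?lhs \<le> (\<Sum>i\<in>I. 2 * card B * (b i)\<^sup>2)"
    proof (rule sum_mono)
      fix i assume i: "i \<in> I"
      have "(sqrt (N (\<lambda>Z. Z - {i} \<in> A)) - sqrt (N (\<lambda>Z. insert i Z \<in> A)))\<^sup>2
          \<le> (N (\<lambda>Z. Z - {i} \<in> A) - N (\<lambda>Z. insert i Z \<in> A))\<^sup>2
              / (N (\<lambda>Z. Z - {i} \<in> A) + N (\<lambda>Z. insert i Z \<in> A))"
        by (rule sqrt_diff_square_le) (use plus[OF i] B in \<open>auto simp: N_def\<close>)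
      also have "\<dots> = 2 * card B * (b i)\<^sup>2"
        unfolding plus[OF i] minus[OF i] using B
        by (simp add: b_def power2_eq_square field_simps)
      finally show "(sqrt (N (\<lambda>Z. Z - {i} \<in> A)) - sqrt (N (\<lambda>Z. insert i Z \<in> A)))\<^sup>2
          \<le> 2 * card B * (b i)\<^sup>2" .
    qed
    also have "\<dots> = 2 * card B * (\<Sum>i\<in>I. (b i)\<^sup>2)"
      by (simp add: sum_distrib_left)
    also have "\<dots> \<le> 2 * card B * (2 * ln (2 ^ card I / card B))"
      unfolding b_def using level_one_inequality[OF \<open>finite I\<close> B(1) False]
      by (intro mult_left_mono) auto
    finally show ?thesis
      by (simp add: NB)
  qed
qed

text \<open>Summing the bound for a single family over the fibres of \<open>\<tau>\<close> produces
  the entropy of \<open>\<tau> Z\<close> for uniform \<open>Z\<close>, which is at most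
  \<open>ln (card K)\<close>.\<close>

lemma hellinger_flip_sum_le_ln_card:
  fixes I :: "'i set" and \<tau> :: "'i set \<Rightarrow> 't"
  defines "N P \<equiv> real (card {Z \<in> Pow I. P Z})"
  assumes "finite I" "finite K" "\<And>Z. \<tau> Z \<in> K"
  shows "(\<Sum>i\<in>I. \<Sum>t\<in>K. (sqrt (N (\<lambda>Z. \<tau> (Z - {i}) = t)) - sqrt (N (\<lambda>Z. \<tau> (insert i Z) = t)))\<^sup>2)
      \<le> 4 * 2 ^ card I * ln (card K)"
proof -
  define M where "M = (2::real) ^ card I"
  define \<nu> where "\<nu> t = N (\<lambda>Z. \<tau> Z = t)" for t
  have M: "M > 0"
    by (simp add: M_def)
  have K: "card K > 0"
    using assms by (auto simp: card_gt_0_iff)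
  have "(\<Sum>t\<in>K. \<nu> t) = real (card (\<Union>t\<in>K. {Z \<in> Pow I. \<tau> Z = t}))"
    unfolding \<nu>_def N_def using assms(2,3) by (subst card_UN_disjoint) auto
  also have "(\<Union>t\<in>K. {Z \<in> Pow I. \<tau> Z = t}) = Pow I"
    using assms(4) by auto
  finally have total: "(\<Sum>t\<in>K. \<nu> t) = M"
    using assms(2) by (simp add: M_def card_Pow)
  \<comment> \<open>Maximality of the uniform entropy, fibre by fibre, from
    \<open>ln z \<le> z - 1\<close>. The corrections \<open>M / card K - \<nu> t\<close> cancel when
    summed over \<open>K\<close>.\<close>
  have entropy: "\<nu> t * ln (M / \<nu> t) \<le> \<nu> t * ln (card K) + (M / card K - \<nu> t)" if "t \<in> K" for t
  proof (cases "\<nu> t = 0")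
    case False
    then have pos: "\<nu> t > 0"
      by (simp add: \<nu>_def N_def)
    have "ln (M / \<nu> t) = ln (card K) + ln (M / (card K * \<nu> t))"
      using pos M K by (subst ln_mult_pos[symmetric]) auto
    also have "\<dots> \<le> ln (card K) + (M / (card K * \<nu> t) - 1)"
      using pos M K by (intro add_left_mono ln_le_minus_one) auto
    finally have "\<nu> t * ln (M / \<nu> t) \<le> \<nu> t * (ln (card K) + (M / (card K * \<nu> t) - 1))"
      using pos by (intro mult_left_mono) auto
    also have "\<dots> = \<nu> t * ln (card K) + (M / card K - \<nu> t)"
      using pos by (simp add: algebra_simps)
    finally show ?thesis .
  qed (use M in simp)
  have "(\<Sum>i\<in>I. \<Sum>t\<in>K. (sqrt (N (\<lambda>Z. \<tau> (Z - {i}) = t)) - sqrt (N (\<lambda>Z. \<tau> (insert i Z) = t)))\<^sup>2)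
      = (\<Sum>t\<in>K. \<Sum>i\<in>I. (sqrt (N (\<lambda>Z. Z - {i} \<in> \<tau> -` {t})) - sqrt (N (\<lambda>Z. insert i Z \<in> \<tau> -` {t})))\<^sup>2)"
    by (subst sum.swap) simp
  also have "\<dots> \<le> (\<Sum>t\<in>K. 4 * (\<nu> t * ln (M / \<nu> t)))"
    using hellinger_flip_sum_le[OF \<open>finite I\<close>, of "\<tau> -` {_}"]
    unfolding N_def \<nu>_def M_def by (intro sum_mono) (simp add: mult.assoc)
  also have "\<dots> \<le> (\<Sum>t\<in>K. 4 * (\<nu> t * ln (card K) + (M / card K - \<nu> t)))"
    by (intro sum_mono mult_left_mono entropy) auto
  also have "\<dots> = 4 * (M * ln (card K))"
    using K by (simp add: sum.distrib sum_subtractf total flip: sum_distrib_left sum_distrib_right)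
  finally show ?thesis
    by (simp add: M_def)
qed

section \<open>Discrepancy of rectangle partitions for disjointness\<close>

text \<open>The cut-and-paste property: exchanging factors does not change the Hellinger affinity, so
  \<open>a0 b0\<close> is as far from \<open>a1 b1\<close> as \<open>a0 b1\<close> is from \<open>a1 b0\<close>, and both of the latter are
  close to \<open>a0 b0\<close>.\<close>

lemma cut_and_paste:
  fixes a0 a1 b0 b1 :: "'t \<Rightarrow> real"
  assumes "\<gamma> > 0"
    and "(\<Sum>t\<in>K. (a0 t * b0 t)\<^sup>2) = M" "(\<Sum>t\<in>K. (a0 t * b1 t)\<^sup>2) = M"
    and "(\<Sum>t\<in>K. (a1 t * b0 t)\<^sup>2) = M" "(\<Sum>t\<in>K. (a1 t * b1 t)\<^sup>2) = M"
    and "\<And>t. a0 t \<ge> 0" "\<And>t. a1 t \<ge> 0" "\<And>t. b0 t \<ge> 0" "\<And>t. b1 t \<ge> 0"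
  shows "(\<Sum>t\<in>K. \<bar>(a0 t * b0 t)\<^sup>2 - (a1 t * b1 t)\<^sup>2\<bar>) \<le> \<gamma> * M +
    2 / \<gamma> * ((\<Sum>t\<in>K. (a0 t * b0 t - a1 t * b0 t)\<^sup>2) + (\<Sum>t\<in>K. (a0 t * b0 t - a0 t * b1 t)\<^sup>2))"
    (is "_ \<le> _ + 2 / \<gamma> * ?h")
proof -
  \<comment> \<open>Weighted AM-GM instead of Cauchy-Schwarz keeps the bound linear in the squared
    Hellinger distance, so that it can later be summed over \<open>i\<close> and
    \<open>D\<close>.\<close>
  have amgm: "\<bar>x\<^sup>2 - y\<^sup>2\<bar> \<le> \<gamma> / 2 * (x\<^sup>2 + y\<^sup>2) + (x - y)\<^sup>2 / \<gamma>"
    if "x \<ge> 0" "y \<ge> 0" for x y :: real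
  proof -
    have "\<bar>x\<^sup>2 - y\<^sup>2\<bar> = \<bar>x - y\<bar> * (x + y)"
      using that by (simp add: power2_eq_square square_diff_square_factored abs_mult)
    also have "\<dots> \<le> \<gamma> / 4 * (x + y)\<^sup>2 + (x - y)\<^sup>2 / \<gamma>"
    proof -
      have "0 \<le> (\<gamma> * (x + y) - 2 * \<bar>x - y\<bar>)\<^sup>2 / (4 * \<gamma>)"
        using \<open>\<gamma> > 0\<close> by simp
      also have "\<dots> = \<gamma> / 4 * (x + y)\<^sup>2 + \<bar>x - y\<bar>\<^sup>2 / \<gamma> - \<bar>x - y\<bar> * (x + y)"
        using \<open>\<gamma> > 0\<close> by (simp add: power2_eq_square field_simps)
      finally show ?thesis
        by simp
    qed
    also have "(x + y)\<^sup>2 \<le> 2 * (x\<^sup>2 + y\<^sup>2)"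
      using zero_le_power2[of "x - y"] by (simp add: power2_eq_square algebra_simps)
    finally show ?thesis
      using \<open>\<gamma> > 0\<close> by (simp add: algebra_simps)
  qed
  have "(\<Sum>t\<in>K. (a0 t * b0 t - a1 t * b1 t)\<^sup>2) = (\<Sum>t\<in>K. (a0 t * b1 t - a1 t * b0 t)\<^sup>2)"
    using assms(2-5) by (simp add: power2_diff sum.distrib sum_subtractf mult_ac)
  also have "\<dots> \<le> (\<Sum>t\<in>K. 2 * (a0 t * b0 t - a1 t * b0 t)\<^sup>2 + 2 * (a0 t * b0 t - a0 t * b1 t)\<^sup>2)"
  proof (rule sum_mono)
    fix t
    have "(u - v)\<^sup>2 \<le> 2 * (w - v)\<^sup>2 + 2 * (w - u)\<^sup>2" for u v w :: real
      using zero_le_power2[of "(w - v) + (w - u)"] by (simp add: power2_eq_square algebra_simps)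
    then show "(a0 t * b1 t - a1 t * b0 t)\<^sup>2
        \<le> 2 * (a0 t * b0 t - a1 t * b0 t)\<^sup>2 + 2 * (a0 t * b0 t - a0 t * b1 t)\<^sup>2" .
  qed
  also have "\<dots> = 2 * ?h"
    by (simp add: sum.distrib sum_distrib_left)
  finally have h: "(\<Sum>t\<in>K. (a0 t * b0 t - a1 t * b1 t)\<^sup>2) \<le> 2 * ?h" .
  have "(\<Sum>t\<in>K. \<bar>(a0 t * b0 t)\<^sup>2 - (a1 t * b1 t)\<^sup>2\<bar>)
      \<le> (\<Sum>t\<in>K. \<gamma> / 2 * ((a0 t * b0 t)\<^sup>2 + (a1 t * b1 t)\<^sup>2) + (a0 t * b0 t - a1 t * b1 t)\<^sup>2 / \<gamma>)"
    using assms by (intro sum_mono amgm) auto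
  also have "\<dots> = \<gamma> * M + (\<Sum>t\<in>K. (a0 t * b0 t - a1 t * b1 t)\<^sup>2) / \<gamma>"
    using assms(2,5) by (simp add: sum.distrib flip: sum_distrib_left sum_divide_distrib)
  also have "\<dots> \<le> \<gamma> * M + 2 * ?h / \<gamma>"
    using h \<open>\<gamma> > 0\<close> by (intro add_left_mono divide_right_mono) auto
  finally show ?thesis
    by simp
qed

text \<open>The parts of a uniform set inside and outside \<open>D\<close> are independent. Together
  with rectangles this gives the transcript counts their product form.\<close>

lemma card_Pow_split:
  assumes "finite I"
  shows "card {Z \<in> Pow I. P (Z \<inter> D) \<and> Q (Z - D)}
    = card {X \<in> Pow (I \<inter> D). P X} * card {Y \<in> Pow (I - D). Q Y}"
proof -
  have "bij_betw (\<lambda>Z. (Z \<inter> D, Z - D)) {Z \<in> Pow I. P (Z \<inter> D) \<and> Q (Z - D)}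
      ({X \<in> Pow (I \<inter> D). P X} \<times> {Y \<in> Pow (I - D). Q Y})"
    by (rule bij_betwI[where g = "\<lambda>(X, Y). X \<union> Y"])
      (auto simp: Int_Un_distrib2 Un_Diff Int_absorb2 Diff_triv subset_eq
        elim!: back_subst[of P] back_subst[of Q])
  from bij_betw_same_card[OF this] show ?thesis
    by (simp add: card_cartesian_product)
qed

definition assign :: "bool \<Rightarrow> 'i \<Rightarrow> 'i set \<Rightarrow> 'i set" where
  "assign v i X = (if v then insert i X else X - {i})"

text \<open>The two halves \<open>Z \<inter> D\<close> and \<open>Z - D\<close> of a random set are disjoint inputs, and putting a
  common element \<open>i\<close> into both makes them intersect in \<open>i\<close> only.\<close>

theorem disjointness_discrepancy:
  fixes I :: "'i set" and T :: "'i set \<Rightarrow> 'i set \<Rightarrow> 't" and S :: "'t set" and \<gamma> :: real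
  defines "acc v i D Z \<equiv> of_bool (T (assign v i (Z \<inter> D)) (assign v i (Z - D)) \<in> S) :: real"
  assumes "finite I" "finite K" "\<And>x y. T x y \<in> K"
    and rectangle: "\<And>x y x' y'. T x y = T x' y' \<Longrightarrow> T x y' = T x y"
    and "\<gamma> > 0"
  shows "(\<Sum>i\<in>I. \<Sum>D\<in>Pow I. \<Sum>Z\<in>Pow I. acc False i D Z - acc True i D Z)
    \<le> 4 ^ card I * (card I * \<gamma> + 16 * ln (card K) / \<gamma>)"
proof -
  define M where "M = (2::real) ^ card I"
  define N where "N P = real (card {Z \<in> Pow I. P Z})" for P
  define n where
    "n u v i D t = N (\<lambda>Z. T (assign u i (Z \<inter> D)) (assign v i (Z - D)) = t)" for u v i D t
  define E where "E i D = (\<Sum>t\<in>K. (sqrt (N (\<lambda>Z. T ((Z - {i}) \<inter> D) (Z - {i} - D) = t))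
      - sqrt (N (\<lambda>Z. T (insert i Z \<inter> D) (insert i Z - D) = t)))\<^sup>2)" for i D
  define A where "A t = {x. \<exists>y. T x y = t}" for t
  define B where "B t = {y. \<exists>x. T x y = t}" for t
  \<comment> \<open>\<open>A t\<close> and \<open>B t\<close> are the sides of the rectangle of
    \<open>t\<close>: if \<open>T x y'\<close> and \<open>T x' y\<close> both equal
    \<open>t\<close>, then so does \<open>T x y\<close>.\<close>
  have T_eq: "T x y = t \<longleftrightarrow> x \<in> A t \<and> y \<in> B t" for x y t
    unfolding A_def B_def using rectangle by (smt (verit) mem_Collect_eq)
  have M2: "M * M = 4 ^ card I"
    by (simp add: M_def flip: power_mult_distrib)
  have total: "(\<Sum>t\<in>K. n u v i D t) = M" for u v i D
  proof -
    let ?Z = "\<lambda>t. {Z \<in> Pow I. T (assign u i (Z \<inter> D)) (assign v i (Z - D)) = t}"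
    have "(\<Sum>t\<in>K. n u v i D t) = real (card (\<Union>t\<in>K. ?Z t))"
      unfolding n_def N_def using assms(2,3) by (subst card_UN_disjoint) auto
    also have "(\<Union>t\<in>K. ?Z t) = Pow I"
      using assms(4) by auto
    finally show ?thesis
      using assms(2) by (simp add: M_def card_Pow)
  qed
  have local: "(\<Sum>t\<in>K. \<bar>n False False i D t - n True True i D t\<bar>)
      \<le> \<gamma> * M + 2 / \<gamma> * (E i (D - {i}) + E i (insert i D))" for i D
  proof -
    define a where "a u t = sqrt (card {X \<in> Pow (I \<inter> D). assign u i X \<in> A t})" for u t
    define b where "b v t = sqrt (card {Y \<in> Pow (I - D). assign v i Y \<in> B t})" for v t
    have ab: "a u t * b v t = sqrt (n u v i D t)" for u v t
      using card_Pow_split[OF \<open>finite I\<close>, of "\<lambda>X. assign u i X \<in> A t" D "\<lambda>Y. assign v i Y \<in> B t"]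
      by (simp add: a_def b_def n_def N_def T_eq real_sqrt_mult)
    have ab2: "(a u t * b v t)\<^sup>2 = n u v i D t" for u v t
      unfolding ab by (simp add: n_def N_def)
    \<comment> \<open>Toggling \<open>i\<close> in \<open>Z\<close> alters only the first input if
      \<open>i\<close> lies in the splitting set, and only the second input otherwise. The other
      input then lacks \<open>i\<close>.\<close>
    have sets: "(Z - {i}) \<inter> insert i D = assign False i (Z \<inter> D)"
        "(Z - {i}) - insert i D = assign False i (Z - D)"
        "insert i Z \<inter> insert i D = assign True i (Z \<inter> D)"
        "insert i Z - insert i D = assign False i (Z - D)"
        "(Z - {i}) \<inter> (D - {i}) = assign False i (Z \<inter> D)"
        "(Z - {i}) - (D - {i}) = assign False i (Z - D)"
        "insert i Z \<inter> (D - {i}) = assign False i (Z \<inter> D)"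
        "insert i Z - (D - {i}) = assign True i (Z - D)" for Z
      by (auto simp: assign_def)
    have E1: "E i (insert i D) = (\<Sum>t\<in>K. (a False t * b False t - a True t * b False t)\<^sup>2)"
      unfolding E_def ab n_def by (simp only: sets)
    have E2: "E i (D - {i}) = (\<Sum>t\<in>K. (a False t * b False t - a False t * b True t)\<^sup>2)"
      unfolding E_def ab n_def by (simp only: sets)
    have "(\<Sum>t\<in>K. \<bar>(a False t * b False t)\<^sup>2 - (a True t * b True t)\<^sup>2\<bar>)
        \<le> \<gamma> * M + 2 / \<gamma> * (E i (insert i D) + E i (D - {i}))"
      unfolding E1 E2
      by (rule cut_and_paste[OF \<open>\<gamma> > 0\<close>]) (simp_all only: ab2 total, simp_all add: a_def b_def)
    then show ?thesis
      by (simp only: ab2 add.commute)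
  qed
  have acc: "(\<Sum>Z\<in>Pow I. acc v i D Z) = (\<Sum>t\<in>K \<inter> S. n v v i D t)" for v i D
  proof -
    let ?Z = "\<lambda>t. {Z \<in> Pow I. T (assign v i (Z \<inter> D)) (assign v i (Z - D)) = t}"
    have "(\<Sum>t\<in>K \<inter> S. n v v i D t) = real (card (\<Union>t\<in>K \<inter> S. ?Z t))"
      unfolding n_def N_def using assms(2,3) by (subst card_UN_disjoint) auto
    also have "(\<Union>t\<in>K \<inter> S. ?Z t)
        = {Z \<in> Pow I. T (assign v i (Z \<inter> D)) (assign v i (Z - D)) \<in> S}"
      using assms(4) by auto
    finally show ?thesis
      using \<open>finite I\<close> by (simp add: acc_def Int_def)
  qed
  have "(\<Sum>Z\<in>Pow I. acc False i D Z - acc True i D Z)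
      \<le> \<gamma> * M + 2 / \<gamma> * (E i (D - {i}) + E i (insert i D))" for i D
  proof -
    have "(\<Sum>Z\<in>Pow I. acc False i D Z - acc True i D Z)
        = (\<Sum>t\<in>K \<inter> S. n False False i D t - n True True i D t)"
      by (simp add: sum_subtractf acc)
    also have "\<dots> \<le> (\<Sum>t\<in>K \<inter> S. \<bar>n False False i D t - n True True i D t\<bar>)"
      by (intro sum_mono) simp
    also have "\<dots> \<le> (\<Sum>t\<in>K. \<bar>n False False i D t - n True True i D t\<bar>)"
      using \<open>finite K\<close> by (intro sum_mono2) auto
    also note local
    finally show ?thesis .
  qed
  then have "(\<Sum>i\<in>I. \<Sum>D\<in>Pow I. \<Sum>Z\<in>Pow I. acc False i D Z - acc True i D Z)
      \<le> (\<Sum>i\<in>I. \<Sum>D\<in>Pow I. \<gamma> * M + 2 / \<gamma> * (E i (D - {i}) + E i (insert i D)))"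
    by (intro sum_mono) blast
  also have "\<dots> = (\<Sum>i\<in>I. M * (\<gamma> * M) + 2 / \<gamma> * (2 * (\<Sum>D\<in>Pow I. E i D)))"
    unfolding sum.distrib[of "\<lambda>_. \<gamma> * M"] sum_distrib_left[of "2 / \<gamma>", symmetric]
    using \<open>finite I\<close> by (intro sum.cong refl) (simp add: sum_Pow_remove_insert card_Pow M_def)
  also have "\<dots> = M * M * (card I * \<gamma>) + 4 / \<gamma> * (\<Sum>i\<in>I. \<Sum>D\<in>Pow I. E i D)"
    by (simp add: sum.distrib sum_distrib_left sum_divide_distrib mult_ac)
  finally have le: "(\<Sum>i\<in>I. \<Sum>D\<in>Pow I. \<Sum>Z\<in>Pow I. acc False i D Z - acc True i D Z)
      \<le> M * M * (card I * \<gamma>) + 4 / \<gamma> * (\<Sum>i\<in>I. \<Sum>D\<in>Pow I. E i D)" .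
  \<comment> \<open>For fixed \<open>D\<close> the transcript is a function of \<open>Z\<close>
    alone with values in \<open>K\<close>, so the entropy bound applies to each \<open>D\<close>
    separately.\<close>
  have "(\<Sum>i\<in>I. \<Sum>D\<in>Pow I. E i D) = (\<Sum>D\<in>Pow I. \<Sum>i\<in>I. E i D)"
    by (rule sum.swap)
  also have "\<dots> \<le> (\<Sum>D\<in>Pow I. 4 * M * ln (card K))"
  proof (rule sum_mono)
    fix D
    show "(\<Sum>i\<in>I. E i D) \<le> 4 * M * ln (card K)"
      using hellinger_flip_sum_le_ln_card[OF \<open>finite I\<close> \<open>finite K\<close>, of "\<lambda>Z. T (Z \<inter> D) (Z - D)"]
        assms(4) unfolding E_def N_def M_def by simp
  qed
  also have "\<dots> = M * M * (4 * ln (card K))"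
    using \<open>finite I\<close> by (simp add: card_Pow M_def)
  finally have "4 / \<gamma> * (\<Sum>i\<in>I. \<Sum>D\<in>Pow I. E i D) \<le> 4 / \<gamma> * (M * M * (4 * ln (card K)))"
    using \<open>\<gamma> > 0\<close> by (intro mult_left_mono) auto
  with le show ?thesis
    by (simp add: M2 algebra_simps)
qed

section \<open>Randomized protocols for disjointness\<close>

text \<open>An averaging argument that fixes the coins: the expected number of events that occur is
  at least \<open>q * card W\<close>.\<close>

lemma (in prob_space) exists_many_events:
  assumes "finite W" "\<And>w. w \<in> W \<Longrightarrow> prob (G w) \<ge> q" "q > 0"
  shows "\<exists>r\<in>space M. q * card W \<le> (\<Sum>w\<in>W. of_bool (r \<in> G w))"
proof (rule ccontr)
  assume "\<not> ?thesis"
  then have less: "(\<Sum>w\<in>W. indicator (G w) r) < q * card W" if "r \<in> space M" for r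
    using that by (auto simp: not_le indicator_def of_bool_def)
  \<comment> \<open>A non-measurable set has measure 0, so a positive lower bound forces
    measurability.\<close>
  have G: "G w \<in> events" if "w \<in> W" for w
    using assms(2)[OF that] assms(3) measure_notin_sets[of "G w" M] by force
  have "expectation (\<lambda>r. \<Sum>w\<in>W. indicator (G w) r) < q * card W"
    using G less by (intro expectation_less) (auto simp: emeasure_eq_measure intro!: AE_I2)
  also have "expectation (\<lambda>r. \<Sum>w\<in>W. indicator (G w) r) = (\<Sum>w\<in>W. prob (G w))"
    using G by (subst Bochner_Integration.integral_sum) (auto simp: emeasure_eq_measure)
  also have "\<dots> \<ge> q * card W"
    using sum_mono[of W "\<lambda>_. q" "\<lambda>w. prob (G w)"] assms(2) by (simp add: mult.commute)
  finally show False
    by simp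
qed

text \<open>For suitably fixed coins the protocol is correct on a fraction
  \<open>1/2 + \<eta>\<close> of the pairs in \<open>W\<close>, half of them disjoint
  (\<open>v\<close> false) and half meeting only in \<open>i\<close>. Correctness means acceptance
  on the former and rejection on the latter, so the acceptance rates differ, against the discrepancy
  bound.\<close>

theorem randomized_disjointness:
  fixes I :: "'i set" and T :: "'r \<Rightarrow> 'i set \<Rightarrow> 'i set \<Rightarrow> 't" and \<eta> :: real
  assumes "prob_space P" "finite I" "finite K" "\<And>r x y. T r x y \<in> K" "\<eta> > 0"
    and rectangle: "\<And>r x y x' y'. T r x y = T r x' y' \<Longrightarrow> T r x y' = T r x y"
    and prob: "\<And>x y. x \<subseteq> I \<Longrightarrow> y \<subseteq> I \<Longrightarrow> measure P (G x y) \<ge> 1/2 + \<eta>"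
    and disjoint: "\<And>r x y. r \<in> G x y \<Longrightarrow> x \<inter> y = {} \<Longrightarrow> T r x y \<in> S r"
    and intersect: "\<And>r x y i. r \<in> G x y \<Longrightarrow> i \<in> I \<Longrightarrow> x \<inter> y = {i} \<Longrightarrow> T r x y \<notin> S r"
  shows "\<eta>\<^sup>2 * card I \<le> 16 * ln (card K)"
proof -
  define x where "x v i D Z = assign v i (Z \<inter> D)" for v and i :: 'i and D Z
  define y where "y v i D Z = assign v i (Z - D)" for v and i :: 'i and D Z
  define W where "W = (UNIV :: bool set) \<times> I \<times> Pow I \<times> Pow I"
  have four: "(2::real) ^ card I * 2 ^ card I = 4 ^ card I"
    by (simp flip: power_mult_distrib)
  have W: "finite W" "real (card W) = 2 * card I * 4 ^ card I"
    using \<open>finite I\<close> by (simp_all add: W_def card_cartesian_product card_Pow four)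
  have "\<exists>r\<in>space P. (1/2 + \<eta>) * card W
      \<le> (\<Sum>w\<in>W. of_bool (r \<in> (case w of (v, i, D, Z) \<Rightarrow> G (x v i D Z) (y v i D Z))))"
  proof (rule prob_space.exists_many_events[OF assms(1) W(1)])
    fix w assume "w \<in> W"
    then show "1/2 + \<eta> \<le> measure P (case w of (v, i, D, Z) \<Rightarrow> G (x v i D Z) (y v i D Z))"
      by (cases w) (auto simp: W_def x_def y_def assign_def intro!: prob)
  qed (use \<open>\<eta> > 0\<close> in auto)
  then obtain r where r: "(1/2 + \<eta>) * card W
      \<le> (\<Sum>w\<in>W. of_bool (r \<in> (case w of (v, i, D, Z) \<Rightarrow> G (x v i D Z) (y v i D Z))))"
    by blast
  define good where "good v i D Z = (of_bool (r \<in> G (x v i D Z) (y v i D Z)) :: real)" for v i D Z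
  define acc where "acc v i D Z = (of_bool (T r (x v i D Z) (y v i D Z) \<in> S r) :: real)" for v i D Z
  have "(\<Sum>w\<in>W. of_bool (r \<in> (case w of (v, i, D, Z) \<Rightarrow> G (x v i D Z) (y v i D Z))))
      = (\<Sum>v\<in>UNIV. \<Sum>i\<in>I. \<Sum>D\<in>Pow I. \<Sum>Z\<in>Pow I. good v i D Z)"
    unfolding W_def sum.cartesian_product by (intro sum.cong) (auto simp: good_def)
  also have "\<dots> = (\<Sum>i\<in>I. \<Sum>D\<in>Pow I. \<Sum>Z\<in>Pow I. good False i D Z + good True i D Z)"
    by (simp add: UNIV_bool sum.distrib)
  also have "\<dots> \<le> (\<Sum>i\<in>I. \<Sum>D\<in>Pow I. \<Sum>Z\<in>Pow I. 1 + (acc False i D Z - acc True i D Z))"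
  proof (intro sum_mono)
    fix i D Z assume "i \<in> I"
    have "x False i D Z \<inter> y False i D Z = {}" "x True i D Z \<inter> y True i D Z = {i}"
      by (auto simp: x_def y_def assign_def)
    then have "good False i D Z \<le> acc False i D Z" "good True i D Z \<le> 1 - acc True i D Z"
      using disjoint[of r "x False i D Z" "y False i D Z"]
        intersect[of r "x True i D Z" "y True i D Z" i] \<open>i \<in> I\<close>
      by (auto simp: good_def acc_def)
    then show "good False i D Z + good True i D Z \<le> 1 + (acc False i D Z - acc True i D Z)"
      by simp
  qed
  also have "\<dots> = card I * 4 ^ card I
      + (\<Sum>i\<in>I. \<Sum>D\<in>Pow I. \<Sum>Z\<in>Pow I. acc False i D Z - acc True i D Z)"
    using \<open>finite I\<close>
    by (simp only: sum.distrib) (simp add: card_Pow four)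
  \<comment> \<open>The advantage is \<open>2 * \<eta>\<close> per index. Taking
    \<open>\<eta>\<close> for \<open>\<gamma>\<close> spends half of it, and the other half bounds
    \<open>ln (card K)\<close>.\<close>
  also have "(\<Sum>i\<in>I. \<Sum>D\<in>Pow I. \<Sum>Z\<in>Pow I. acc False i D Z - acc True i D Z)
      \<le> 4 ^ card I * (card I * \<eta> + 16 * ln (card K) / \<eta>)"
    unfolding acc_def x_def y_def
    by (rule disjointness_discrepancy[OF assms(2,3) assms(4) rectangle \<open>\<eta> > 0\<close>])
  finally have "4 ^ card I * (card I * \<eta>) \<le> 4 ^ card I * (16 * ln (card K) / \<eta>)"
    using r unfolding W(2) by (simp add: algebra_simps)
  then have "card I * \<eta> \<le> 16 * ln (card K) / \<eta>"
    by (rule mult_left_le_imp_le) simp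
  then show ?thesis
    using \<open>\<eta> > 0\<close> by (simp add: field_simps power2_eq_square)
qed

section \<open>Streaming passes as a two-party protocol\<close>

lemma memory_cong:
  assumes "t \<le> t'" "length xs = length ys" "memory M r xs t = memory M r ys t"
    and "\<And>s. t \<le> s \<Longrightarrow> s < t' \<Longrightarrow> xs ! (s mod length xs) = ys ! (s mod length ys)"
  shows "memory M r xs t' = memory M r ys t'"
  using assms by (induction t' rule: dec_induct) auto

text \<open>The states in which the stream passes from one of the two players, who hold \<open>u\<close> and
  \<open>v\<close>, to the other.\<close>

definition transcript :: "nat \<Rightarrow> 'a machine \<Rightarrow> tape \<Rightarrow> 'a list \<Rightarrow> 'a list \<Rightarrow> bool list list" where
  "transcript p M r u v =
     map (\<lambda>j. memory M r (u @ v) (j div 2 * length (u @ v) + (if odd j then length u else 0)))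
       [0..<2 * p + 1]"

text \<open>The run on \<open>u\<close>, \<open>v'\<close> is followed from boundary to boundary.
  While the first part is read it agrees with the run on \<open>u\<close>, \<open>v\<close>; while
  the second is read it agrees with the run on \<open>u'\<close>, \<open>v'\<close>, whose boundary
  states are the same.\<close>

lemma transcript_rectangle:
  assumes "length u = length u'" "length v = length v'"
    and eq: "transcript p M r u v = transcript p M r u' v'"
  shows "transcript p M r u v' = transcript p M r u v"
proof -
  define n where "n = length (u @ v)"
  define t where "t j = j div 2 * n + (if odd j then length u else 0)" for j :: nat
  have n: "length (u @ v) = n" "length (u @ v') = n" "length (u' @ v') = n"
    using assms by (simp_all add: n_def)
  have same: "memory M r (u @ v) (t j) = memory M r (u' @ v') (t j)" if "j \<le> 2 * p" for j
    using eq that unfolding transcript_def n t_def \<open>length u = length u'\<close>[symmetric]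
    by (simp add: map_eq_conv less_Suc_eq_le del: upt_Suc)
  have "memory M r (u @ v') (t j) = memory M r (u @ v) (t j)" if "j \<le> 2 * p" for j
    using that
  proof (induction j)
    case (Suc j)
    show ?case
    proof (cases "even j")
      case True
      then have tj: "t j = j div 2 * n" "t (Suc j) = j div 2 * n + length u"
        by (simp_all add: t_def)
      show ?thesis
      proof (rule memory_cong[of "t j"])
        fix s assume s: "t j \<le> s" "s < t (Suc j)"
        obtain a where a: "s = j div 2 * n + a"
          using s tj le_Suc_ex by metis
        then have "a < length u"
          using s tj by simp
        moreover have "a < n"
          using \<open>a < length u\<close> by (simp add: n_def)
        ultimately show "(u @ v') ! (s mod length (u @ v')) = (u @ v) ! (s mod length (u @ v))"
          unfolding n a by (simp add: nth_append)
      qed (use Suc tj n in auto)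
    next
      case False
      then have tj: "t j = j div 2 * n + length u" "t (Suc j) = j div 2 * n + n"
        by (simp_all add: t_def)
      have "memory M r (u @ v') (t (Suc j)) = memory M r (u' @ v') (t (Suc j))"
      proof (rule memory_cong[of "t j"])
        fix s assume s: "t j \<le> s" "s < t (Suc j)"
        obtain a where a: "s = j div 2 * n + a"
          using s tj le_Suc_ex by (metis add_leD1)
        then have "length u \<le> a" "a < n"
          using s tj by auto
        then show "(u @ v') ! (s mod length (u @ v')) = (u' @ v') ! (s mod length (u' @ v'))"
          unfolding n a using assms(1) by (simp add: nth_append)
      qed (use Suc tj n same[of j] in \<open>auto simp: n_def\<close>)
      then show ?thesis
        using same Suc.prems by simp
    qed
  qed (simp add: t_def)
  then show ?thesis
    unfolding transcript_def n t_def by (simp add: less_Suc_eq_le del: upt_Suc)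
qed

lemma transcript_memory_time:
  assumes "j < 2 * p + 1"
  shows "j div 2 * length (u @ v) + (if odd j then length u else 0) \<le> p * length (u @ v)"
proof (cases "even j")
  case True
  have "j div 2 \<le> p"
    using assms by simp
  then have "j div 2 * length (u @ v) \<le> p * length (u @ v)"
    by (rule mult_right_mono) simp
  with True show ?thesis
    by simp
next
  case False
  then have "Suc (j div 2) \<le> p"
    using assms by (auto elim!: oddE)
  then have "Suc (j div 2) * length (u @ v) \<le> p * length (u @ v)"
    by (rule mult_right_mono) simp
  with False show ?thesis
    by simp
qed

lemma last_transcript: "last (transcript p M r u v) = memory M r (u @ v) (p * length (u @ v))"
  by (simp add: transcript_def)

lemma card_transcripts:
  fixes L s :: nat
  defines "K \<equiv> {ts :: bool list list. set ts \<subseteq> {b. length b \<le> s} \<and> length ts = L}"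
  shows "finite K" "ln (card K) \<le> L * (s + 1)"
proof -
  have B: "{b :: bool list. length b \<le> s} = {b. set b \<subseteq> UNIV \<and> length b \<le> s}"
    by auto
  have fin: "finite {b :: bool list. length b \<le> s}"
    unfolding B by (rule finite_lists_length_le) simp
  then show "finite K"
    unfolding K_def by (rule finite_lists_length_eq)
  have "card {b :: bool list. length b \<le> s} = (\<Sum>i\<le>s. 2 ^ i)"
    unfolding B by (subst card_lists_length_le) (simp_all add: card_UNIV_bool)
  also have "\<dots> \<le> 2 ^ (s + 1)"
    by (induction s) auto
  finally have B_le: "card {b :: bool list. length b \<le> s} \<le> 2 ^ (s + 1)" .
  have "card K = card {b :: bool list. length b \<le> s} ^ L"
    unfolding K_def using fin by (rule card_lists_length_eq)
  also have "\<dots> \<le> (2 ^ (s + 1)) ^ L"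
    using B_le by (rule power_mono) simp
  also have "\<dots> = 2 ^ (L * (s + 1))"
    by (simp only: power_mult[symmetric] mult.commute)
  finally have le: "real (card K) \<le> 2 ^ (L * (s + 1))"
    by (metis of_nat_le_iff of_nat_numeral of_nat_power)
  show "ln (card K) \<le> L * (s + 1)"
  proof (cases "card K = 0")
    case False
    then have "ln (card K) \<le> ln (2 ^ (L * (s + 1)))"
      using le by (subst ln_le_cancel_iff) auto
    also have "\<dots> = L * (s + 1) * ln 2"
      by (simp add: ln_realpow)
    also have "\<dots> \<le> L * (s + 1)"
      using ln_2_less_1 by (intro mult_left_le) auto
    finally show ?thesis .
  qed simp
qed

section \<open>The hard streams and their diversity index\<close>

lemma sum_list_map_eq_sum_nth: "(\<Sum>x\<leftarrow>xs. g x) = (\<Sum>i<length xs. g (xs ! i))"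
  by (simp add: sum_list_sum_nth atLeast0LessThan)

lemma DI_eq_sum_list: "DI f xs = (\<Sum>x\<leftarrow>xs. inverse (\<Sum>y\<leftarrow>xs. f x y))"
  by (simp add: DI_def node_degree_def sum_list_map_eq_sum_nth)

lemma DI_map: "DI f (map h xs) = DI (\<lambda>a b. f (h a) (h b)) xs"
  by (simp add: DI_eq_sum_list o_def)

text \<open>The Boolean records whether the player holds the index. The last argument of
  \<open>Leaf\<close> makes the \<open>k\<close> leaves of an index distinct, and
  \<open>Filler\<close> pads the stream to length \<open>n\<close>.\<close>

datatype item = Leaf bool nat nat | Hub bool nat | Filler

instance item :: countable
  by countable_datatype

text \<open>A hub of \<open>i\<close> is linked to the leaves of \<open>i\<close> unless both players hold \<open>i\<close>. So the
  leaves of \<open>i\<close> contribute about 1 to the diversity index, except when both players hold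
  \<open>i\<close>: then each of the \<open>k\<close> leaves is isolated and contributes 1.\<close>

fun linked :: "item \<Rightarrow> item \<Rightarrow> bool" where
  "linked (Leaf u i l) (Hub v j) \<longleftrightarrow> i = j \<and> \<not> (u \<and> v)"
| "linked (Hub v j) (Leaf u i l) \<longleftrightarrow> i = j \<and> \<not> (u \<and> v)"
| "linked a b \<longleftrightarrow> a = b"

lemma linked_refl: "linked a a"
  by (cases a) auto

lemma linked_commute: "linked a b \<longleftrightarrow> linked b a"
  by (cases a; cases b) auto

definition leaves :: "nat \<Rightarrow> nat \<Rightarrow> nat set \<Rightarrow> item list" where
  "leaves m k x = concat (map (\<lambda>i. map (Leaf (i \<in> x) i) [0..<k]) [0..<m])"

definition hubs :: "nat \<Rightarrow> nat \<Rightarrow> nat set \<Rightarrow> item list" where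
  "hubs m k y = concat (map (\<lambda>i. replicate k (Hub (i \<in> y) i)) [0..<m])"

lemma length_leaves: "length (leaves m k x) = m * k"
  by (simp add: leaves_def length_concat o_def sum_list_triv)

lemma length_hubs: "length (hubs m k y) = m * k"
  by (simp add: hubs_def length_concat o_def sum_list_triv)

lemma sum_list_leaves:
  "(\<Sum>a\<leftarrow>leaves m k x. g a) = (\<Sum>i<m. \<Sum>l<k. g (Leaf (i \<in> x) i l))" for g :: "item \<Rightarrow> real"
  unfolding leaves_def
  by (induction m) (simp_all add: o_def sum_list_map_eq_sum_nth)

lemma sum_list_hubs:
  "(\<Sum>a\<leftarrow>hubs m k y. g a) = (\<Sum>i<m. k * g (Hub (i \<in> y) i))" for g :: "item \<Rightarrow> real"
  unfolding hubs_def
  by (induction m) (simp_all add: map_replicate_const sum_list_replicate)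

text \<open>If \<open>i\<close> is not shared, its leaves have degree \<open>k + 1\<close> and its
  hubs degree \<open>2 * k\<close>. If it is shared, the leaves have degree 1 and the hubs degree
  \<open>k\<close>. The \<open>q\<close> fillers have degree \<open>q\<close> and contribute 1 in
  total, if there are any.\<close>

lemma DI_leaves_hubs:
  fixes m k q :: nat and x y :: "nat set"
  assumes "k \<ge> 1"
  shows "DI (\<lambda>a b. of_bool (linked a b)) (leaves m k x @ hubs m k y @ replicate q Filler)
    = (\<Sum>i<m. if i \<in> x \<inter> y then real k + 1 else k / (real k + 1) + 1 / 2) + of_bool (q > 0)"
proof -
  let ?xs = "leaves m k x @ hubs m k y @ replicate q Filler"
  define deg :: "item \<Rightarrow> real" where "deg a = (\<Sum>b\<leftarrow>?xs. of_bool (linked a b))" for a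
  have deg_eq: "deg a = (\<Sum>i<m. \<Sum>l<k. of_bool (linked a (Leaf (i \<in> x) i l)))
      + (\<Sum>i<m. real k * of_bool (linked a (Hub (i \<in> y) i))) + q * of_bool (linked a Filler)" for a
    by (simp add: deg_def sum_list_leaves sum_list_hubs sum_list_replicate)
  have leaf: "deg (Leaf (j \<in> x) j l) = 1 + k * of_bool (j \<notin> x \<inter> y)" if "j < m" "l < k" for j l
  proof -
    have "(\<Sum>i<m. \<Sum>l'<k. of_bool (linked (Leaf (j \<in> x) j l) (Leaf (i \<in> x) i l')))
        = (\<Sum>i<m. \<Sum>l'<k. if i = j then if l' = l then 1 else 0 else (0 :: real))"
      by (intro sum.cong) auto
    also have "\<dots> = (\<Sum>i<m. if i = j then \<Sum>l'<k. if l' = l then 1 else 0 else (0 :: real))"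
      by (intro sum.cong) auto
    also have "\<dots> = 1"
      using that by simp
    finally have 1: "(\<Sum>i<m. \<Sum>l'<k. of_bool (linked (Leaf (j \<in> x) j l) (Leaf (i \<in> x) i l'))) = (1::real)" .
    have "(\<Sum>i<m. real k * of_bool (linked (Leaf (j \<in> x) j l) (Hub (i \<in> y) i)))
        = (\<Sum>i<m. if i = j then real k * of_bool (j \<notin> x \<inter> y) else (0 :: real))"
      by (intro sum.cong) auto
    also have "\<dots> = real k * of_bool (j \<notin> x \<inter> y)"
      using that by simp
    finally have 2: "(\<Sum>i<m. real k * of_bool (linked (Leaf (j \<in> x) j l) (Hub (i \<in> y) i)))
        = real k * of_bool (j \<notin> x \<inter> y)" .
    show ?thesis
      unfolding deg_eq 1 2 by simp
  qed
  have hub: "deg (Hub (j \<in> y) j) = k + k * of_bool (j \<notin> x \<inter> y)" if "j < m" for j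
  proof -
    have "(\<Sum>i<m. \<Sum>l'<k. of_bool (linked (Hub (j \<in> y) j) (Leaf (i \<in> x) i l')))
        = (\<Sum>i<m. if i = j then real k * of_bool (j \<notin> x \<inter> y) else (0 :: real))"
      by (intro sum.cong) auto
    also have "\<dots> = real k * of_bool (j \<notin> x \<inter> y)"
      using that by simp
    finally have 1: "(\<Sum>i<m. \<Sum>l'<k. of_bool (linked (Hub (j \<in> y) j) (Leaf (i \<in> x) i l')))
        = real k * (of_bool (j \<notin> x \<inter> y) :: real)" .
    have "(\<Sum>i<m. real k * of_bool (linked (Hub (j \<in> y) j) (Hub (i \<in> y) i)))
        = (\<Sum>i<m. if i = j then real k else (0 :: real))"
      by (intro sum.cong) auto
    also have "\<dots> = real k"
      using that by simp
    finally have 2: "(\<Sum>i<m. real k * of_bool (linked (Hub (j \<in> y) j) (Hub (i \<in> y) i))) = real k" .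
    show ?thesis
      unfolding deg_eq 1 2 by simp
  qed
  have filler: "deg Filler = q"
    by (simp add: deg_eq)
  have "DI (\<lambda>a b. of_bool (linked a b)) ?xs = (\<Sum>a\<leftarrow>?xs. inverse (deg a))"
    by (simp only: DI_eq_sum_list deg_def)
  also have "\<dots> = (\<Sum>i<m. \<Sum>l<k. inverse (deg (Leaf (i \<in> x) i l)))
      + (\<Sum>i<m. k * inverse (deg (Hub (i \<in> y) i))) + q * inverse (deg Filler)"
    by (simp add: sum_list_leaves sum_list_hubs sum_list_replicate)
  also have "\<dots> = (\<Sum>i<m. k * inverse (1 + k * of_bool (i \<notin> x \<inter> y)))
      + (\<Sum>i<m. k * inverse (k + k * of_bool (i \<notin> x \<inter> y))) + of_bool (q > 0)"
    by (simp add: leaf hub filler del: Int_iff)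
  also have "(\<Sum>i<m. k * inverse (1 + k * of_bool (i \<notin> x \<inter> y)))
      + (\<Sum>i<m. k * inverse (k + k * of_bool (i \<notin> x \<inter> y)))
      = (\<Sum>i<m. if i \<in> x \<inter> y then real k + 1 else k / (real k + 1) + 1 / 2)"
  proof -
    have "real k * inverse (real k + real k) = 1 / 2" "real k * inverse (real k) = 1"
      using assms by (simp_all add: field_simps)
    moreover have "real k * inverse (1 + real k) = k / (real k + 1)"
      by (simp add: divide_inverse add.commute)
    ultimately show ?thesis
      unfolding sum.distrib[symmetric] by (intro sum.cong refl) auto
  qed
  finally show ?thesis .
qed

section \<open>The space lower bound\<close>

text \<open>The first player streams the leaves, the second the hubs and the filler. Comparing the
  output with a threshold then decides disjointness on \<open>m\<close> indices, so the bound for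
  randomized protocols limits \<open>m\<close> in terms of the space \<open>s\<close>.\<close>

theorem DI_space_lower_bound:
  fixes A :: "'a algorithm" and \<epsilon> :: real and p m k n s :: nat
  assumes "infinite (UNIV :: 'a set)" "approximates_DI p n \<epsilon> 0.49 A" "space_bits p n A \<le> enat s"
    and "0 < \<epsilon>" "\<epsilon> < 0.9" "m \<ge> 1" "2 * m * k \<le> n" "100 * \<epsilon> * m < k"
  shows "m \<le> 160000 * (2 * p + 1) * (s + 1)"
proof -
  \<comment> \<open>The countable type \<open>item\<close> embeds into any infinite type. As
    \<open>linked\<close> is reflexive and symmetric, its pullback along \<open>inv h\<close> is a
    similarity even off the range of \<open>h\<close>.\<close>
  obtain e :: "nat \<Rightarrow> 'a" where "inj e"
    using assms(1) infinite_countable_subset by blast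
  define h where "h = e \<circ> (to_nat :: item \<Rightarrow> nat)"
  have h: "inj h"
    unfolding h_def using \<open>inj e\<close> by (intro inj_compose inj_to_nat)
  define f where "f a b = (of_bool (linked (inv h a) (inv h b)) :: real)" for a b
  have f: "similarity UNIV f" "f (h a) (h b) = of_bool (linked a b)" for a b
    using h by (auto simp: similarity_def f_def linked_refl linked_commute)
  have k: "k \<ge> 1"
    using assms by (cases k) (auto simp: mult_less_0_iff)
  define q where "q = n - 2 * m * k"
  define u where "u x = map h (leaves m k x)" for x
  define v where "v y = map h (hubs m k y @ replicate q Filler)" for y
  define M where "M = A UNIV f"
  have "m * k + (m * k + q) = n"
    using assms(7) unfolding q_def by linarith
  then have len: "length (u x) = m * k" "length (u x @ v y) = n" "length (v y) = m * k + q" for x y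
    by (simp_all add: u_def v_def length_leaves length_hubs)
  have inst: "(UNIV, f, u x @ v y) \<in> instances n" for x y
    using f len by (auto simp: instances_def simp del: length_append)
  define b where "b = k / (real k + 1) + 1 / 2"
  define X where "X = m * b + of_bool (q > 0)"
  define \<Delta> where "\<Delta> = k + 1 - b"
  have DI_eq: "DI f (u x @ v y) = (\<Sum>i<m. if i \<in> x \<inter> y then real k + 1 else b) + of_bool (q > 0)" for x y
    using DI_leaves_hubs[OF k, of m x y q]
    by (simp only: u_def v_def map_append[symmetric] DI_map f(2) b_def)
  have disj: "DI f (u x @ v y) = X" if "x \<inter> y = {}" for x y
    by (simp add: DI_eq that X_def)
  have inter: "DI f (u x @ v y) = X + \<Delta>" if "i < m" "x \<inter> y = {i}" for x y i
  proof -
    have "(\<Sum>j<m. if j \<in> x \<inter> y then real k + 1 else b) = (\<Sum>j<m. b + (if j = i then \<Delta> else 0))"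
      unfolding that(2) by (intro sum.cong) (auto simp: \<Delta>_def)
    also have "\<dots> = m * b + \<Delta>"
      using that(1) by (simp add: sum.distrib)
    finally show ?thesis
      by (simp add: DI_eq X_def)
  qed
  \<comment> \<open>This amounts to \<open>2 * \<epsilon> * X < (1 - \<epsilon>) * \<Delta>\<close>.
    The left side is at most \<open>5 * \<epsilon> * m\<close>, hence below \<open>k / 20\<close>;
    the right side is at least \<open>k / 20\<close>, since \<open>1 - \<epsilon>\<close> exceeds
    0.1 and \<open>\<Delta>\<close> is at least \<open>k / 2\<close>.\<close>
  have gap: "(1 + \<epsilon>) * X < (1 - \<epsilon>) * (X + \<Delta>)"
  proof -
    have b: "b \<le> 3/2"
      by (simp add: b_def field_simps)
    then have "m * b \<le> m * (3/2)"
      by (intro mult_left_mono) auto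
    moreover have "of_bool (q > 0) \<le> (1 :: real)" "1 \<le> real m"
      using \<open>m \<ge> 1\<close> by simp_all
    ultimately have "X \<le> 5/2 * m"
      unfolding X_def by linarith
    then have "\<epsilon> * X \<le> \<epsilon> * (5/2 * m)"
      using \<open>0 < \<epsilon>\<close> by (intro mult_left_mono) auto
    then have 1: "2 * (\<epsilon> * X) < k / 20"
      using assms(8) by simp
    have "\<Delta> \<ge> k / 2"
      using b k by (simp add: \<Delta>_def)
    then have "(1 - \<epsilon>) * \<Delta> \<ge> 0.1 * (k / 2)"
      using \<open>\<epsilon> < 0.9\<close> by (intro mult_mono) auto
    then show ?thesis
      using 1 by (simp add: algebra_simps)
  qed
  define G where
    "G x y = {r \<in> space coins. (1 - \<epsilon>) * DI f (u x @ v y) \<le> final_output p M (u x @ v y) r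
      \<and> final_output p M (u x @ v y) r \<le> (1 + \<epsilon>) * DI f (u x @ v y)}" for x y
  \<comment> \<open>The success probability 0.51 gives advantage 0.01, whence the constant
    \<open>16 / 0.01^2 = 160000\<close>.\<close>
  have G: "measure coins (G x y) \<ge> 1/2 + 0.01" for x y
    using assms(2) inst[of x y] by (fastforce simp: approximates_DI_def approximation_def G_def M_def)
  define S where "S r = {ts. result M r (last ts) \<le> (1 + \<epsilon>) * X}" for r
  define T where "T r x y = transcript p M r (u x) (v y)" for r x y
  define K where "K = {ts :: bool list list. set ts \<subseteq> {b. length b \<le> s} \<and> length ts = 2 * p + 1}"
  have out: "final_output p M (u x @ v y) r = result M r (last (T r x y))" for x y r
    by (simp only: final_output_def T_def last_transcript)
  have coins: "prob_space coins"
    unfolding coins_def by (intro prob_space_PiM measure_pmf.prob_space_axioms)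
  have "finite K"
    unfolding K_def by (rule card_transcripts)
  have T_K: "T r x y \<in> K" for r x y
  proof -
    have "length (memory M r (u x @ v y) t) \<le> s" if "t \<le> p * n" for t
    proof -
      have "enat (length (memory M r (u x @ v y) t)) \<le> space_bits p n A"
        unfolding space_bits_def M_def
        by (rule SUP_upper2[OF inst[of x y]], simp only: prod.case,
            rule SUP_upper2[of r], simp add: coins_def space_PiM, rule SUP_upper) (use that in simp)
      then show ?thesis
        using assms(3) order_trans by fastforce
    qed
    moreover have "j div 2 * n + (if odd j then m * k else 0) \<le> p * n" if "j < 2 * p + 1" for j
      using transcript_memory_time[OF that, of "u x" "v y"] unfolding len .
    ultimately show ?thesis
      unfolding K_def T_def transcript_def len by auto
  qed
  have rectangle: "T r x y' = T r x y" if "T r x y = T r x' y'" for r x y x' y'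
    using that unfolding T_def by (intro transcript_rectangle) (simp_all add: len)
  have disj: "T r x y \<in> S r" if "r \<in> G x y" "x \<inter> y = {}" for r x y
    using that by (auto simp: G_def S_def disj out)
  have inter: "T r x y \<notin> S r" if "r \<in> G x y" "i \<in> {..<m}" "x \<inter> y = {i}" for r x y i
    using that gap by (auto simp: G_def S_def inter out)
  have "(0.01)\<^sup>2 * card {..<m} \<le> 16 * ln (card K)"
    by (rule randomized_disjointness[OF coins finite_lessThan \<open>finite K\<close> T_K _ rectangle G disj inter])
      simp
  also have "ln (card K) \<le> (2 * p + 1) * (s + 1)"
    unfolding K_def by (rule card_transcripts)
  finally have "real m \<le> real (160000 * (2 * p + 1) * (s + 1))"
    by (simp add: power2_eq_square algebra_simps)
  then show ?thesis
    by (simp only: of_nat_le_iff)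
qed

theorem theorem21:
  fixes p :: nat
  assumes "infinite (UNIV :: 'a set)"
    and "p \<ge> 1"
  shows "\<exists>c>0. \<exists>n\<^sub>0. \<forall>n\<ge>n\<^sub>0. \<forall>\<epsilon>::real. 0 < \<epsilon> \<and> \<epsilon> < 0.9 \<longrightarrow>
           (\<forall>A :: 'a algorithm. approximates_DI p n \<epsilon> 0.49 A \<longrightarrow>
              ereal (c * min (sqrt (real n / \<epsilon>)) (real n)) \<le> ereal_of_enat (space_bits p n A))"
proof -
  \<comment> \<open>This is \<open>125 * 160000 * (2 * p + 1)\<close>. The bound on
    \<open>m\<close>, multiplied by 30, becomes \<open>6 / 25 * C * (s + 1)\<close>, and for
    \<open>M \<ge> C\<close> the terms without \<open>s\<close> stay below
    \<open>M / 2\<close>.\<close>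
  define C where "C = 20000000 * (2 * real p + 1)"
  have C: "C \<ge> 20000000"
    by (simp add: C_def)
  have bound: "ereal (1 / C * min (sqrt (n / \<epsilon>)) n) \<le> ereal_of_enat (space_bits p n A)"
    if n: "n \<ge> nat \<lceil>C\<^sup>2\<rceil>" and \<epsilon>: "0 < \<epsilon>" "\<epsilon> < 0.9" and A: "approximates_DI p n \<epsilon> 0.49 A"
    for n \<epsilon> and A :: "'a algorithm"
  proof (cases "space_bits p n A")
    case (enat s)
    define M where "M = min (sqrt (n / \<epsilon>)) n"
    \<comment> \<open>As \<open>m\<close> is at most \<open>n / 30\<close>, \<open>k\<close> is
      positive and \<open>n < 4 * m * k\<close>. As \<open>m\<close> is at most
      \<open>sqrt (n / \<epsilon>) / 30\<close>, also \<open>400 * \<epsilon> * m^2 \<le> n\<close>.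
      Together these give \<open>100 * \<epsilon> * m < k\<close>.\<close>
    define m where "m = nat \<lfloor>M / 30\<rfloor>"
    define k where "k = n div (2 * m)"
    have "0 \<le> C * s"
      using C by simp
    have Cn: "C\<^sup>2 \<le> n"
      using n by linarith
    have "C \<le> M"
    proof -
      have "C \<le> sqrt n"
        using Cn by (rule real_le_rsqrt)
      also have "sqrt n \<le> sqrt (n / \<epsilon>)"
        using \<epsilon> by (simp add: pos_le_divide_eq mult_left_le)
      finally have "C \<le> sqrt (n / \<epsilon>)" .
      moreover have "C \<le> C\<^sup>2"
        using C by (simp add: power2_eq_square)
      ultimately show ?thesis
        using Cn by (simp add: M_def)
    qed
    have m: "m \<le> M / 30" "M / 30 < m + 1"
      using \<open>C \<le> M\<close> C unfolding m_def by linarith+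
    then have m1: "m \<ge> 1"
      using \<open>C \<le> M\<close> C by linarith
    have "M \<le> n"
      by (simp add: M_def)
    then have "real (2 * m) \<le> real n"
      using m(1) by simp
    then have "k \<ge> 1"
      using m1 unfolding k_def of_nat_le_iff by (simp add: Suc_leI div_greater_zero_iff)
    have "n < 2 * m * (k + 1)"
      using dividend_less_div_times[of "2 * m" n] m1 by (simp add: k_def algebra_simps)
    also have "\<dots> \<le> 2 * m * (2 * k)"
      using \<open>k \<ge> 1\<close> by (intro mult_left_mono) auto
    finally have "real n < real (2 * m * (2 * k))"
      by (simp only: of_nat_less_iff)
    then have nk: "n < 4 * (real m * k)"
      by simp
    have "(real m)\<^sup>2 \<le> (sqrt (n / \<epsilon>) / 30)\<^sup>2"
      using m(1) by (intro power_mono) (auto simp: M_def)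
    also have "\<dots> = n / \<epsilon> / 900"
      using \<epsilon> by (simp add: power_divide)
    finally have "real m * (400 * \<epsilon> * m) \<le> n"
      using \<epsilon> by (simp add: field_simps power2_eq_square)
    with nk have "real m * (400 * \<epsilon> * m) < real m * (4 * k)"
      by linarith
    then have "100 * \<epsilon> * m < k"
      by (simp add: mult_less_cancel_left)
    moreover have "2 * m * k \<le> n"
      by (simp add: k_def)
    ultimately have "m \<le> 160000 * (2 * p + 1) * (s + 1)"
      using DI_space_lower_bound[OF assms(1) A, of s m k] enat \<epsilon> m1 by simp
    then have "real m \<le> real (160000 * (2 * p + 1) * (s + 1))"
      by (simp only: of_nat_le_iff)
    also have "\<dots> = C / 125 * (s + 1)"
      by (simp add: C_def algebra_simps)
    finally have "M < 30 + 30 / 125 * C * (s + 1)"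
      using m(2) by (simp add: field_simps)
    also have "\<dots> = 30 + 6 / 25 * C + 6 / 25 * (C * s)"
      by (simp add: algebra_simps)
    also have "\<dots> \<le> M / 2 + C * s / 2"
      using C \<open>C \<le> M\<close> \<open>0 \<le> C * s\<close> by linarith
    finally have "M \<le> C * s"
      by simp
    then show ?thesis
      using C by (simp add: enat M_def field_simps)
  qed simp
  have "1 / C > 0"
    using C by simp
  with bound show ?thesis
    by blast
qed

end
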